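(* Let $n,m\ge 1$, let $Q_0,Q_1,\dots,Q_m\in\mathbb{S}^n$, $\beta_0,\dots,\beta_m\in\mathbb{R}^n$ and $\gamma_0,\dots,\gamma_m\in\mathbb{R}$ be the data of the quadratically constrained quadratic program $$\min_{w\in\mathbb{R}^n}\ w^TQ_0w+\beta_0^Tw+\gamma_0\quad\text{subject to}\quad w^TQ_kw+\beta_k^Tw+\gamma_k\le 0\quad(k=1,\dots,m).$$ Suppose that all the diagonal elements of $Q_0,Q_1,\dots,Q_m$ are zero. Then the optimal values of the semidefinite programming, second order cone programming and linear programming relaxations of this problem coincide: $$\zeta_{SDP}^*=\zeta_{SOCP}^*=\zeta_{LP}^*.$$
   Context: $\mathbb{S}^n$ is the space of real symmetric $n\times n$ matrices and $\mathbb{S}^{n}_+$ the cone of positive semidefinite ones. For symmetric matrices, $A\bullet B=\sum_{i}\sum_{k}A_{ik}B_{ik}$. The $Q_k$ are not assumed positive semidefinite. Define the $(n+1)\times(n+1)$ symmetric matrices $$\bar Q_k=\begin{pmatrix}\gamma_k&\beta_k^T/2\\ \beta_k/2&Q_k\end{pmatrix}\ (k=0,\dots,m),\qquad \bar H_0=\begin{pmatrix}1&0^T\\0&O\end{pmatrix}.$$ Each relaxation minimizes $\bar Q_0\bullet\bar W$ over $\bar W\in\mathbb{S}^{n+1}$ subject to $\bar Q_k\bullet\bar W\le 0$ $(k=1,\dots,m)$, $\bar H_0\bullet\bar W=1$, and in addition: - SDP relaxation (optimal value $\zeta^*_{SDP}$): $\bar W\in\mathbb{S}^{n+1}_+$;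 - SOCP relaxation (optimal value $\zeta^*_{SOCP}$): $\left\|\begin{pmatrix}\bar W_{ii}-\bar W_{jj}\\ 2\bar W_{ij}\end{pmatrix}\right\|\le \bar W_{ii}+\bar W_{jj}$ for $1\le i<j\le n+1$ (Euclidean norm), equivalently $\bar W_{ii}\ge0$ for all $i$ and $\bar W_{ij}^2\le\bar W_{ii}\bar W_{jj}$ for all $i<j$; - LP relaxation (optimal value $\zeta^*_{LP}$): $\bar W_{ii}\ge 0$ for $1\le i\le n+1$ and $\bar W_{ii}+\bar W_{jj}-2|\bar W_{ij}|\ge 0$ for $1\le i<j\le n+1$. Optimal values are understood as infima in $[-\infty,+\infty]$, with value $+\infty$ if the problem is infeasible. *)

theory Defs
  imports
    "Jordan_Normal_Form.Matrix"
    "HOL-Analysis.Product_Vector"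
    "HOL-Library.Extended_Real"
begin

(* Matrices are those of Jordan_Normal_Form: row and column indices start at 0,
   so index 0 of an (n+1) x (n+1) matrix is the homogenizing coordinate. *)

definition sym_mats :: "nat \<Rightarrow> real mat set" where
  "sym_mats n = {A \<in> carrier_mat n n. transpose_mat A = A}"

definition psd_mats :: "nat \<Rightarrow> real mat set" where
  "psd_mats n = {A \<in> sym_mats n. \<forall>x \<in> carrier_vec n. 0 \<le> scalar_prod x (A *\<^sub>v x)}"

definition mat_inner :: "real mat \<Rightarrow> real mat \<Rightarrow> real" where
  "mat_inner A B = (\<Sum>i<dim_row A. \<Sum>k<dim_col A. A $$ (i, k) * B $$ (i, k))"

definition Q_bar :: "real mat \<Rightarrow> real vec \<Rightarrow> real \<Rightarrow> real mat" where
  "Q_bar Q \<beta> \<gamma> = four_block_mat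
     (mat 1 1 (\<lambda>_. \<gamma>)) (mat 1 (dim_vec \<beta>) (\<lambda>(_, j). \<beta> $ j / 2))
     (mat (dim_vec \<beta>) 1 (\<lambda>(i, _). \<beta> $ i / 2)) Q"

definition H0_bar :: "nat \<Rightarrow> real mat" where
  "H0_bar n = four_block_mat (1\<^sub>m 1) (0\<^sub>m 1 n) (0\<^sub>m n 1) (0\<^sub>m n n)"

(* The norm on real \<times> real is the Euclidean one. *)
definition socp_mats :: "nat \<Rightarrow> real mat set" where
  "socp_mats N = {W \<in> sym_mats N. \<forall>i j. i < j \<and> j < N \<longrightarrow>
     norm (W $$ (i, i) - W $$ (j, j), 2 * W $$ (i, j)) \<le> W $$ (i, i) + W $$ (j, j)}"

definition lp_mats :: "nat \<Rightarrow> real mat set" where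
  "lp_mats N = {W \<in> sym_mats N. (\<forall>i<N. 0 \<le> W $$ (i, i)) \<and>
     (\<forall>i j. i < j \<and> j < N \<longrightarrow> 0 \<le> W $$ (i, i) + W $$ (j, j) - 2 * \<bar>W $$ (i, j)\<bar>)}"

(* The quadratic program: minimize w^T Q_0 w + beta_0^T w + gamma_0 over w in R^n
   subject to w^T Q_k w + beta_k^T w + gamma_k \<le> 0 for k = 1, ..., m.
   Its relaxations replace the lifted matrix (1, w)(1, w)^T by a symmetric matrix W
   and differ only in the set K to which W is restricted. *)

definition relax_feasible ::
  "nat \<Rightarrow> nat \<Rightarrow> (nat \<Rightarrow> real mat) \<Rightarrow> (nat \<Rightarrow> real vec) \<Rightarrow> (nat \<Rightarrow> real) \<Rightarrow> real mat set \<Rightarrow> real mat set"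
  where
  "relax_feasible n m Q \<beta> \<gamma> K = {W \<in> sym_mats (n + 1).
     (\<forall>k\<in>{1..m}. mat_inner (Q_bar (Q k) (\<beta> k) (\<gamma> k)) W \<le> 0) \<and>
     mat_inner (H0_bar n) W = 1 \<and> W \<in> K}"

(* The infimum over the empty set is \<infinity> in ereal. *)
definition relax_value ::
  "nat \<Rightarrow> nat \<Rightarrow> (nat \<Rightarrow> real mat) \<Rightarrow> (nat \<Rightarrow> real vec) \<Rightarrow> (nat \<Rightarrow> real) \<Rightarrow> real mat set \<Rightarrow> ereal"
  where
  "relax_value n m Q \<beta> \<gamma> K =
     (INF W \<in> relax_feasible n m Q \<beta> \<gamma> K. ereal (mat_inner (Q_bar (Q 0) (\<beta> 0) (\<gamma> 0)) W))"

definition zeta_SDP ::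
  "nat \<Rightarrow> nat \<Rightarrow> (nat \<Rightarrow> real mat) \<Rightarrow> (nat \<Rightarrow> real vec) \<Rightarrow> (nat \<Rightarrow> real) \<Rightarrow> ereal" where
  "zeta_SDP n m Q \<beta> \<gamma> = relax_value n m Q \<beta> \<gamma> (psd_mats (n + 1))"

definition zeta_SOCP ::
  "nat \<Rightarrow> nat \<Rightarrow> (nat \<Rightarrow> real mat) \<Rightarrow> (nat \<Rightarrow> real vec) \<Rightarrow> (nat \<Rightarrow> real) \<Rightarrow> ereal" where
  "zeta_SOCP n m Q \<beta> \<gamma> = relax_value n m Q \<beta> \<gamma> (socp_mats (n + 1))"

definition zeta_LP ::
  "nat \<Rightarrow> nat \<Rightarrow> (nat \<Rightarrow> real mat) \<Rightarrow> (nat \<Rightarrow> real vec) \<Rightarrow> (nat \<Rightarrow> real) \<Rightarrow> ereal" where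
  "zeta_LP n m Q \<beta> \<gamma> = relax_value n m Q \<beta> \<gamma> (lp_mats (n + 1))"

end

(* Apart from the corner entry, the diagonal of the lifted matrix W enters neither the
   objective nor the constraints, while the corner entry is fixed to 1.  Hence all the other
   diagonal entries may be raised until W becomes positive semidefinite, so any relaxation
   over a set containing the positive semidefinite matrices has the value of the SDP. *)
theory Submission
  imports Defs "HOL-Analysis.L2_Norm"
begin

lemma scalar_prod_mult_mat_vec:
  assumes "A \<in> carrier_mat N N" and "x \<in> carrier_vec N"
  shows "scalar_prod x (A *\<^sub>v x) = (\<Sum>i<N. \<Sum>j<N. A $$ (i, j) * x $ i * (x $ j :: real))"
proof -
  have "scalar_prod x (A *\<^sub>v x) = (\<Sum>i<N. x $ i * (\<Sum>j<N. A $$ (i, j) * x $ j))"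
    using assms by (auto simp: scalar_prod_def lessThan_atLeast0 intro!: sum.cong)
  then show ?thesis by (simp add: sum_distrib_left mult_ac)
qed

lemma psd_mats_diag_nonneg:
  assumes "W \<in> psd_mats N" and "i < N"
  shows "0 \<le> W $$ (i, i)"
proof -
  have W: "W \<in> carrier_mat N N" using assms by (simp add: psd_mats_def sym_mats_def)
  have "0 \<le> scalar_prod (unit_vec N i) (W *\<^sub>v unit_vec N i)"
    using assms by (simp add: psd_mats_def)
  also have "\<dots> = W $$ (i, i)"
    using W assms by simp
  finally show ?thesis .
qed

text \<open>Positive semidefiniteness is tested on the vector with entry \<open>a\<close> at
  \<open>i\<close>, entry \<open>b\<close> at \<open>j\<close> and zeros elsewhere. Suitable
  \<open>a\<close> and \<open>b\<close> later yield both the second order cone and the linear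
  inequalities.\<close>

lemma psd_mats_two_by_two:
  assumes "W \<in> psd_mats N" and "i < N" and "j < N" and "i \<noteq> j"
  shows "0 \<le> W $$ (i, i) * a\<^sup>2 + 2 * W $$ (i, j) * a * b + W $$ (j, j) * b\<^sup>2"
proof -
  let ?x = "vec N (\<lambda>k. if k = i then a else if k = j then b else 0)"
  have W: "W \<in> carrier_mat N N" and T: "transpose_mat W = W"
    using assms by (simp_all add: psd_mats_def sym_mats_def)
  have sym: "W $$ (j, i) = W $$ (i, j)"
    using T W assms by (metis carrier_matD index_transpose_mat(1))
  have two: "(\<Sum>k<N. f k * (?x $ k)) = f i * a + f j * b" for f :: "nat \<Rightarrow> real"
  proof -
    have "(\<Sum>k<N. f k * (?x $ k)) = (\<Sum>k\<in>{i, j}. f k * (?x $ k))"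
      using assms by (intro sum.mono_neutral_right) auto
    then show ?thesis using assms by simp
  qed
  have "0 \<le> scalar_prod ?x (W *\<^sub>v ?x)"
    using assms(1) by (simp add: psd_mats_def)
  also have "\<dots> = (\<Sum>k<N. \<Sum>l<N. W $$ (k, l) * ?x $ k * ?x $ l)"
    by (rule scalar_prod_mult_mat_vec[OF W]) simp
  also have "\<dots> = (\<Sum>k<N. (W $$ (k, i) * a + W $$ (k, j) * b) * ?x $ k)"
    by (subst two) (simp add: algebra_simps)
  also have "\<dots> = (W $$ (i, i) * a + W $$ (i, j) * b) * a + (W $$ (j, i) * a + W $$ (j, j) * b) * b"
    by (rule two)
  finally show ?thesis using sym by (simp add: algebra_simps power2_eq_square)
qed

lemma psd_mats_minor_nonneg:
  assumes "W \<in> psd_mats N" and "i < N" and "j < N" and "i \<noteq> j"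
  shows "(W $$ (i, j))\<^sup>2 \<le> W $$ (i, i) * W $$ (j, j)"
proof -
  define p q r where "p = W $$ (i, i)" and "q = W $$ (j, j)" and "r = W $$ (i, j)"
  have form: "0 \<le> p * a\<^sup>2 + 2 * r * a * b + q * b\<^sup>2" for a b
    using psd_mats_two_by_two[OF assms] by (simp add: p_def q_def r_def)
  have nonneg: "0 \<le> p" "0 \<le> q"
    using psd_mats_diag_nonneg assms by (auto simp: p_def q_def)
  have "r\<^sup>2 \<le> p * q"
  \<comment> \<open>The form at \<open>(-r, p)\<close> and at \<open>(q, -r)\<close> equals
    \<open>p\<close> and \<open>q\<close> times the determinant \<open>p * q - r\<^sup>2\<close>,
    which settles the sign once \<open>p\<close> or \<open>q\<close> is positive. If both vanish,
    the form is linear in \<open>r\<close>, and the arguments \<open>(1, 1)\<close> and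
    \<open>(1, -1)\<close> force \<open>r = 0\<close>.\<close>
  proof (cases "p = 0 \<and> q = 0")
    case True
    then have "r = 0" using form[of 1 1] form[of 1 "-1"] by simp
    then show ?thesis using True by simp
  next
    case False
    have "0 \<le> p * (p * q - r\<^sup>2)" "0 \<le> q * (p * q - r\<^sup>2)"
      using form[of "-r" p] form[of q "-r"] by (simp_all add: algebra_simps power2_eq_square)
    then show ?thesis using False nonneg by (auto simp: zero_le_mult_iff)
  qed
  then show ?thesis by (simp add: p_def q_def r_def)
qed

text \<open>Squaring the cone inequality \<open>norm (p - q, 2 * r) \<le> p + q\<close> and
  cancelling leaves the minor condition \<open>r\<^sup>2 \<le> p * q\<close>.\<close>

lemma psd_mats_subset_socp_mats: "psd_mats N \<subseteq> socp_mats N"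
proof
  fix W assume W: "W \<in> psd_mats N"
  have "norm (W $$ (i, i) - W $$ (j, j), 2 * W $$ (i, j)) \<le> W $$ (i, i) + W $$ (j, j)"
    if "i < j" "j < N" for i j
    unfolding norm_prod_def
  proof (rule real_le_lsqrt)
    show "0 \<le> W $$ (i, i) + W $$ (j, j)"
      using psd_mats_diag_nonneg[OF W] that by simp
    show "(norm (fst (W $$ (i, i) - W $$ (j, j), 2 * W $$ (i, j))))\<^sup>2
        + (norm (snd (W $$ (i, i) - W $$ (j, j), 2 * W $$ (i, j))))\<^sup>2
        \<le> (W $$ (i, i) + W $$ (j, j))\<^sup>2"
      using psd_mats_minor_nonneg[OF W, of i j] that
      by (simp add: power2_eq_square algebra_simps)
  qed
  then show "W \<in> socp_mats N" using W by (simp add: socp_mats_def psd_mats_def)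
qed

text \<open>The vectors with entries \<open>1, 1\<close> and \<open>1, -1\<close> at
  \<open>i, j\<close> bound the off-diagonal entry from both sides, hence its absolute
  value.\<close>

lemma psd_mats_subset_lp_mats: "psd_mats N \<subseteq> lp_mats N"
proof
  fix W assume W: "W \<in> psd_mats N"
  have "0 \<le> W $$ (i, i) + W $$ (j, j) - 2 * \<bar>W $$ (i, j)\<bar>" if "i < j" "j < N" for i j
    using psd_mats_two_by_two[OF W, of i j 1 1] psd_mats_two_by_two[OF W, of i j 1 "-1"] that
    by (simp add: abs_if)
  then show "W \<in> lp_mats N"
    using W psd_mats_diag_nonneg[OF W] by (simp add: lp_mats_def psd_mats_def)
qed

text \<open>Index 0 is spared because the normalization by \<open>H0_bar\<close> fixes the corner
  entry. One common value \<open>t\<close> suffices for all other diagonal entries.\<close>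

definition lift_diag :: "real \<Rightarrow> real mat \<Rightarrow> real mat" where
  "lift_diag t W = mat (dim_row W) (dim_col W)
     (\<lambda>(i, j). if i = j \<and> i \<noteq> 0 then t else W $$ (i, j))"

lemma mat_inner_lift_diag:
  assumes "A \<in> carrier_mat N N" and "W \<in> carrier_mat N N"
    and "\<And>i. 0 < i \<Longrightarrow> i < N \<Longrightarrow> A $$ (i, i) = 0"
  shows "mat_inner A (lift_diag t W) = mat_inner A W"
  using assms unfolding mat_inner_def lift_diag_def by (intro sum.cong) auto

lemma lift_diag_sym:
  assumes "W \<in> sym_mats N"
  shows "lift_diag t W \<in> sym_mats N"
proof -
  have W: "W \<in> carrier_mat N N" and T: "transpose_mat W = W"
    using assms by (simp_all add: sym_mats_def)
  have "W $$ (j, i) = W $$ (i, j)" if "i < N" "j < N" for i j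
    using T W that by (metis carrier_matD index_transpose_mat(1))
  then show ?thesis using W by (auto simp: sym_mats_def lift_diag_def)
qed

text \<open>Since the corner entry is 1, completing the square in coordinate 0 leaves a quadratic
  form in the other coordinates \<open>y\<close>, reduced by the square of a linear form
  \<open>R\<close>. A large enough diagonal dominates that square and the off-diagonal terms
  alike.\<close>

lemma ex_lift_diag_psd:
  assumes "W \<in> sym_mats (Suc n)" and "W $$ (0, 0) = 1"
  obtains t where "lift_diag t W \<in> psd_mats (Suc n)"
proof -
  have W: "W \<in> carrier_mat (Suc n) (Suc n)" and T: "transpose_mat W = W"
    using assms by (simp_all add: sym_mats_def)
  have sym: "W $$ (j, i) = W $$ (i, j)" if "i < Suc n" "j < Suc n" for i j
    using T W that by (metis carrier_matD index_transpose_mat(1))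
  define b where "b = (\<Sum>p\<in>{..<Suc n} \<times> {..<Suc n}. \<bar>W $$ p\<bar>)"
  have b: "\<bar>W $$ (i, j)\<bar> \<le> b" if "i < Suc n" "j < Suc n" for i j
    unfolding b_def using that by (intro member_le_sum) auto
  have b0: "0 \<le> b" unfolding b_def by (simp add: sum_nonneg)
  \<comment> \<open>With \<open>S\<close> the sum of the absolute values of the \<open>y i\<close>,
    the square of \<open>R\<close> costs at most \<open>b\<^sup>2 * S\<^sup>2\<close> and the
    off-diagonal terms at most \<open>b * S\<^sup>2\<close>. The factor \<open>n\<close> comes from
    bounding \<open>S\<^sup>2\<close> by \<open>n\<close> times the sum of squares.\<close>
  define c where "c = real n * (b\<^sup>2 + b)"
  define V where "V = lift_diag (c + b) W"
  have "0 \<le> scalar_prod x (V *\<^sub>v x)" if x: "x \<in> carrier_vec (Suc n)" for x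
  proof -
    define a and y where "a = x $ 0" and "y = (\<lambda>i. x $ Suc i)"
    define S where "S = (\<Sum>i<n. \<bar>y i\<bar>)"
    define R where "R = (\<Sum>i<n. W $$ (0, Suc i) * y i)"
    have R: "\<bar>R\<bar> \<le> b * S"
      unfolding R_def S_def sum_distrib_left
      by (rule order.trans[OF sum_abs]) (auto simp: abs_mult intro!: sum_mono mult_right_mono b)
    have V0: "V $$ (0, 0) = 1" "\<And>i. i < n \<Longrightarrow> V $$ (0, Suc i) = W $$ (0, Suc i)"
      "\<And>i. i < n \<Longrightarrow> V $$ (Suc i, 0) = W $$ (0, Suc i)"
      using W assms(2) sym by (auto simp: V_def lift_diag_def)
    \<comment> \<open>The loss with factor \<open>b\<close> is charged to the diagonal terms as
      well, so that the double sum of all losses is exactly \<open>b * S\<^sup>2\<close>. On the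
      diagonal the bound holds because \<open>c - b \<le> c + b\<close>.\<close>
    have entry: "- (b * (\<bar>y i\<bar> * \<bar>y j\<bar>)) + (if i = j then c * (y j)\<^sup>2 else 0)
        \<le> V $$ (Suc i, Suc j) * y i * y j" if "i < n" "j < n" for i j
    proof (cases "i = j")
      case True
      then show ?thesis using W that b0
        by (simp add: V_def lift_diag_def algebra_simps power2_eq_square)
    next
      case False
      have "\<bar>W $$ (Suc i, Suc j) * y i * y j\<bar> \<le> b * (\<bar>y i\<bar> * \<bar>y j\<bar>)"
        using b[of "Suc i" "Suc j"] that
        by (simp add: abs_mult mult.assoc mult_right_mono)
      then show ?thesis using W that False by (simp add: V_def lift_diag_def)
    qed
    have "(\<Sum>i<n. \<Sum>j<n. - (b * (\<bar>y i\<bar> * \<bar>y j\<bar>)) + (if i = j then c * (y j)\<^sup>2 else 0))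
        \<le> (\<Sum>i<n. \<Sum>j<n. V $$ (Suc i, Suc j) * y i * y j)"
      by (intro sum_mono entry) auto
    moreover have "(\<Sum>i<n. \<Sum>j<n. - (b * (\<bar>y i\<bar> * \<bar>y j\<bar>)) + (if i = j then c * (y j)\<^sup>2 else 0))
        = c * (\<Sum>i<n. (y i)\<^sup>2) - b * S\<^sup>2"
      unfolding S_def power2_eq_square[of "sum _ _"] sum_product
      by (simp add: sum.distrib sum_negf sum_distrib_left sum_subtractf)
    ultimately have inner: "c * (\<Sum>i<n. (y i)\<^sup>2) - b * S\<^sup>2
        \<le> (\<Sum>i<n. \<Sum>j<n. V $$ (Suc i, Suc j) * y i * y j)" by simp
    \<comment> \<open>Cauchy-Schwarz against the constant vector 1.\<close>
    have "S \<le> L2_set (\<lambda>i. 1) {..<n} * L2_set y {..<n}"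
      unfolding S_def using L2_set_mult_ineq[of "\<lambda>i. 1" y "{..<n}"] by simp
    then have "S\<^sup>2 \<le> (L2_set (\<lambda>i. 1) {..<n} * L2_set y {..<n})\<^sup>2"
      by (rule power_mono) (simp add: S_def sum_nonneg)
    also have "\<dots> = real n * (\<Sum>i<n. (y i)\<^sup>2)"
      by (simp add: L2_set_def power_mult_distrib sum_nonneg)
    finally have "(b\<^sup>2 + b) * S\<^sup>2 \<le> (b\<^sup>2 + b) * (real n * (\<Sum>i<n. (y i)\<^sup>2))"
      using b0 by (intro mult_left_mono) simp_all
    also have "\<dots> = c * (\<Sum>i<n. (y i)\<^sup>2)"
      by (simp only: c_def mult_ac)
    finally have CS: "(b\<^sup>2 + b) * S\<^sup>2 \<le> c * (\<Sum>i<n. (y i)\<^sup>2)" .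
    have "R\<^sup>2 \<le> b\<^sup>2 * S\<^sup>2"
      using power_mono[OF R, of 2] by (simp add: power_mult_distrib)
    \<comment> \<open>Completing the square: \<open>a\<^sup>2 + 2 * a * R\<close> is at least
      \<open>- R\<^sup>2\<close>, hence at least \<open>- b\<^sup>2 * S\<^sup>2\<close>, and
      \<open>CS\<close> pays for this together with \<open>b * S\<^sup>2\<close>.\<close>
    moreover have "0 \<le> (a + R)\<^sup>2" by simp
    ultimately have "0 \<le> a\<^sup>2 + 2 * a * R + (c * (\<Sum>i<n. (y i)\<^sup>2) - b * S\<^sup>2)"
      using CS by (simp add: power2_sum algebra_simps)
    also have "\<dots> \<le> a\<^sup>2 + 2 * a * R + (\<Sum>i<n. \<Sum>j<n. V $$ (Suc i, Suc j) * y i * y j)"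
      using inner by simp
    \<comment> \<open>Index 0 is split off both sums: the corner gives \<open>a\<^sup>2\<close>, and
      row 0 and column 0 each give \<open>a * R\<close> by symmetry.\<close>
    also have "\<dots> = (\<Sum>i<Suc n. \<Sum>j<Suc n. V $$ (i, j) * x $ i * x $ j)"
      unfolding sum.lessThan_Suc_shift
      by (simp add: V0 sum.distrib sum_distrib_left R_def a_def y_def power2_eq_square
          mult_ac flip: sum.distrib)
    also have "\<dots> = scalar_prod x (V *\<^sub>v x)"
      using W x by (intro scalar_prod_mult_mat_vec[symmetric]) (simp_all add: V_def lift_diag_def)
    finally show ?thesis .
  qed
  then have "V \<in> psd_mats (Suc n)"
    using lift_diag_sym[OF assms(1)] by (simp add: psd_mats_def V_def)
  then show thesis using that by (simp add: V_def)
qed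

text \<open>This turns the normalization constraint into the hypothesis on the corner entry in
  \<open>ex_lift_diag_psd\<close>.\<close>

lemma mat_inner_H0_bar:
  assumes "W \<in> carrier_mat (Suc n) (Suc n)"
  shows "mat_inner (H0_bar n) W = W $$ (0, 0)"
proof -
  have "mat_inner (H0_bar n) W
      = (\<Sum>i<Suc n. \<Sum>k<Suc n. (if i = 0 \<and> k = 0 then 1 else 0) * W $$ (i, k))"
    unfolding mat_inner_def H0_bar_def
    by (intro sum.cong) (auto simp: four_block_mat_def Let_def)
  then show ?thesis by (simp add: sum.lessThan_Suc_shift del: sum.lessThan_Suc)
qed

text \<open>Enlarging the feasible set can only lower the infimum. Conversely, each point feasible
  for \<open>K\<close> is matched by a positive semidefinite feasible point with the same objective.
  Comparing point by point requires no attained minimum and covers infeasible and unbounded problems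
  too.\<close>

lemma relax_value_eq_psd:
  assumes psd: "psd_mats (n + 1) \<subseteq> K"
    and Q: "\<And>k. k \<le> m \<Longrightarrow> Q k \<in> sym_mats n"
    and \<beta>: "\<And>k. k \<le> m \<Longrightarrow> \<beta> k \<in> carrier_vec n"
    and diag: "\<And>k i. k \<le> m \<Longrightarrow> i < n \<Longrightarrow> Q k $$ (i, i) = 0"
  shows "relax_value n m Q \<beta> \<gamma> K = relax_value n m Q \<beta> \<gamma> (psd_mats (n + 1))"
proof (rule antisym)
  show "relax_value n m Q \<beta> \<gamma> K \<le> relax_value n m Q \<beta> \<gamma> (psd_mats (n + 1))"
    unfolding relax_value_def
    by (rule INF_superset_mono) (use psd in \<open>auto simp: relax_feasible_def\<close>)
  show "relax_value n m Q \<beta> \<gamma> (psd_mats (n + 1)) \<le> relax_value n m Q \<beta> \<gamma> K"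
    unfolding relax_value_def
  proof (rule INF_mono)
    fix W assume feas: "W \<in> relax_feasible n m Q \<beta> \<gamma> K"
    then have Ws: "W \<in> sym_mats (Suc n)" by (simp add: relax_feasible_def)
    then have W: "W \<in> carrier_mat (Suc n) (Suc n)" by (simp add: sym_mats_def)
    have "W $$ (0, 0) = 1"
      using feas by (simp add: relax_feasible_def mat_inner_H0_bar[OF W])
    then obtain t where V: "lift_diag t W \<in> psd_mats (Suc n)"
      using ex_lift_diag_psd[OF Ws] by blast
    \<comment> \<open>Below its corner, the diagonal of \<open>Q_bar\<close> is that of
      \<open>Q k\<close>, shifted by one index, hence zero.\<close>
    have inner: "mat_inner (Q_bar (Q k) (\<beta> k) (\<gamma> k)) (lift_diag t W)
        = mat_inner (Q_bar (Q k) (\<beta> k) (\<gamma> k)) W" if "k \<le> m" for k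
      using Q[OF that] \<beta>[OF that] diag[OF that]
      by (intro mat_inner_lift_diag[OF _ W]) (auto simp: Q_bar_def sym_mats_def)
    have "mat_inner (H0_bar n) (lift_diag t W) = mat_inner (H0_bar n) W"
      by (intro mat_inner_lift_diag[OF _ W]) (auto simp: H0_bar_def)
    then have "lift_diag t W \<in> relax_feasible n m Q \<beta> \<gamma> (psd_mats (n + 1))"
      using feas V inner by (simp add: relax_feasible_def psd_mats_def)
    then show "\<exists>V\<in>relax_feasible n m Q \<beta> \<gamma> (psd_mats (n + 1)).
        ereal (mat_inner (Q_bar (Q 0) (\<beta> 0) (\<gamma> 0)) V)
        \<le> ereal (mat_inner (Q_bar (Q 0) (\<beta> 0) (\<gamma> 0)) W)"
      using inner[of 0] by (intro bexI[of _ "lift_diag t W"]) simp_all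
  qed
qed

theorem theorem4p1:
  fixes n m :: nat
    and Q :: "nat \<Rightarrow> real mat"
    and \<beta> :: "nat \<Rightarrow> real vec"
    and \<gamma> :: "nat \<Rightarrow> real"
  assumes "n \<ge> 1" and "m \<ge> 1"
    and "\<And>k. k \<le> m \<Longrightarrow> Q k \<in> sym_mats n"
    and "\<And>k. k \<le> m \<Longrightarrow> \<beta> k \<in> carrier_vec n"
    and "\<And>k i. k \<le> m \<Longrightarrow> i < n \<Longrightarrow> Q k $$ (i, i) = 0"
  shows "zeta_SDP n m Q \<beta> \<gamma> = zeta_SOCP n m Q \<beta> \<gamma> \<and>
         zeta_SOCP n m Q \<beta> \<gamma> = zeta_LP n m Q \<beta> \<gamma>"
  unfolding zeta_SDP_def zeta_SOCP_def zeta_LP_def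
  using relax_value_eq_psd[OF psd_mats_subset_socp_mats, of m Q n \<beta> \<gamma>]
    relax_value_eq_psd[OF psd_mats_subset_lp_mats, of m Q n \<beta> \<gamma>] assms(3-5)
  by simp

end
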